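(* Let $\alpha\ge\beta>0$ and let $y^\delta\in Y$. Every minimizer $x\in\ell_2$ over $\ell_2$ of $$\mathcal{J}_{\alpha,\beta}^{\delta}(x)=\frac12\|Ax-y^\delta\|_Y^2+\alpha\|x\|_{\ell_1}^2-\beta\|x\|_{\ell_2}^2$$ is sparse, i.e. has only finitely many nonzero components.
   Context: $\ell_2$ is the real Hilbert space of square-summable sequences indexed by $\mathbb{N}$, $Y$ is a Hilbert space, and $A:\ell_2\to Y$ is a bounded linear operator. For $x\in\ell_2\setminus\ell_1$ one sets $\|x\|_{\ell_1}=+\infty$ and $\mathcal{J}_{\alpha,\beta}^{\delta}(x)=+\infty$. *)

theory Defs
  imports "HOL-Analysis.Analysis"
begin

section \<open>The real Hilbert space of square-summable sequences\<close>

typedef ell2 = "{x :: nat \<Rightarrow> real. summable (\<lambda>n. (x n)\<^sup>2)}"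
  morphisms ell2_nth Abs_ell2
  by (rule exI[of _ "\<lambda>_. 0"]) simp

setup_lifting type_definition_ell2

lemma summable_ell2_nth: "summable (\<lambda>n. (ell2_nth x n)\<^sup>2)"
  using ell2_nth[of x] by simp

lemma ell2_eqI: "(\<And>n. ell2_nth x n = ell2_nth y n) \<Longrightarrow> x = y"
  by (simp add: ell2_nth_inject[symmetric] fun_eq_iff)

lemma summable_mult_of_squares:
  fixes f g :: "nat \<Rightarrow> real"
  assumes f: "summable (\<lambda>n. (f n)\<^sup>2)" and g: "summable (\<lambda>n. (g n)\<^sup>2)"
  shows "summable (\<lambda>n. f n * g n)"
proof (rule summable_comparison_test[OF _ summable_add[OF f g]], intro exI allI impI)
  fix n :: nat
  have "2 * (\<bar>f n\<bar> * \<bar>g n\<bar>) \<le> (f n)\<^sup>2 + (g n)\<^sup>2"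
    using sum_squares_bound[of "\<bar>f n\<bar>" "\<bar>g n\<bar>"] by simp
  then show "norm (f n * g n) \<le> (f n)\<^sup>2 + (g n)\<^sup>2"
    by (simp add: abs_mult) (use zero_le_mult_iff[of "\<bar>f n\<bar>" "\<bar>g n\<bar>"] in linarith)
qed

lemma summable_square_add:
  fixes f g :: "nat \<Rightarrow> real"
  assumes f: "summable (\<lambda>n. (f n)\<^sup>2)" and g: "summable (\<lambda>n. (g n)\<^sup>2)"
  shows "summable (\<lambda>n. (f n + g n)\<^sup>2)"
  using summable_add[OF summable_add[OF f g]
      summable_mult[OF summable_mult_of_squares[OF f g], of 2]]
  by (simp add: power2_sum mult.assoc)

lemma summable_square_scale:
  fixes f :: "nat \<Rightarrow> real"
  shows "summable (\<lambda>n. (f n)\<^sup>2) \<Longrightarrow> summable (\<lambda>n. (r * f n)\<^sup>2)"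
  by (simp add: power_mult_distrib summable_mult)

instantiation ell2 :: real_vector
begin

lift_definition zero_ell2 :: ell2 is "\<lambda>_. 0"
  by simp

lift_definition plus_ell2 :: "ell2 \<Rightarrow> ell2 \<Rightarrow> ell2" is "\<lambda>x y n. x n + y n"
  by (rule summable_square_add)

lift_definition uminus_ell2 :: "ell2 \<Rightarrow> ell2" is "\<lambda>x n. - x n"
  by simp

lift_definition minus_ell2 :: "ell2 \<Rightarrow> ell2 \<Rightarrow> ell2" is "\<lambda>x y n. x n - y n"
  subgoal for x y using summable_square_add[of x "\<lambda>n. - y n"] by simp
  done

lift_definition scaleR_ell2 :: "real \<Rightarrow> ell2 \<Rightarrow> ell2" is "\<lambda>r x n. r * x n"
  by (rule summable_square_scale)

instance
  by standard (transfer, simp add: fun_eq_iff algebra_simps)+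

end

instantiation ell2 :: real_inner
begin

definition inner_ell2 :: "ell2 \<Rightarrow> ell2 \<Rightarrow> real"
  where "inner (x :: ell2) y = (\<Sum>n. ell2_nth x n * ell2_nth y n)"

definition norm_ell2 :: "ell2 \<Rightarrow> real"
  where "norm (x :: ell2) = sqrt (\<Sum>n. (ell2_nth x n)\<^sup>2)"

definition dist_ell2 :: "ell2 \<Rightarrow> ell2 \<Rightarrow> real"
  where "dist (x :: ell2) y = norm (x - y)"

definition sgn_ell2 :: "ell2 \<Rightarrow> ell2"
  where "sgn (x :: ell2) = inverse (norm x) *\<^sub>R x"

definition uniformity_ell2 :: "(ell2 \<times> ell2) filter"
  where "(uniformity :: (ell2 \<times> ell2) filter) = (INF e\<in>{0 <..}. principal {(x :: ell2, y). dist x y < e})"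

definition open_ell2 :: "ell2 set \<Rightarrow> bool"
  where "open (S :: ell2 set) = (\<forall>x\<in>S. \<forall>\<^sub>F (x', y) in uniformity. x' = x \<longrightarrow> y \<in> S)"

instance
proof
  fix x y z :: ell2 and r :: real
  have sm: "summable (\<lambda>n. ell2_nth x n * ell2_nth y n)" for x y
    by (intro summable_mult_of_squares summable_ell2_nth)
  show "inner x y = inner y x"
    by (simp add: inner_ell2_def mult.commute)
  show "inner (x + y) z = inner x z + inner y z"
    by (simp add: inner_ell2_def plus_ell2.rep_eq distrib_right suminf_add sm)
  show "inner (r *\<^sub>R x) y = r * inner x y"
    by (simp add: inner_ell2_def scaleR_ell2.rep_eq mult.assoc suminf_mult sm)
  show "0 \<le> inner x x"
    by (simp add: inner_ell2_def suminf_nonneg sm)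
  show "inner x x = 0 \<longleftrightarrow> x = 0"
    using suminf_eq_zero_iff[OF sm[of x x]]
    by (auto simp: inner_ell2_def zero_ell2.rep_eq intro: ell2_eqI)
  show "norm x = sqrt (inner x x)"
    by (simp add: norm_ell2_def inner_ell2_def power2_eq_square)
qed (rule dist_ell2_def sgn_ell2_def uniformity_ell2_def open_ell2_def)+

end

lemma sum_squares_le_norm_ell2: "(\<Sum>n<k. (ell2_nth x n)\<^sup>2) \<le> (norm x)\<^sup>2"
  by (simp add: norm_ell2_def suminf_nonneg summable_ell2_nth sum_le_suminf)

lemma abs_ell2_nth_le_norm: "\<bar>ell2_nth x n\<bar> \<le> norm x"
proof (rule power2_le_imp_le)
  have "(ell2_nth x n)\<^sup>2 \<le> (\<Sum>i<Suc n. (ell2_nth x i)\<^sup>2)"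
    by (simp add: sum_nonneg)
  also have "\<dots> \<le> (norm x)\<^sup>2"
    by (rule sum_squares_le_norm_ell2)
  finally show "\<bar>ell2_nth x n\<bar>\<^sup>2 \<le> (norm x)\<^sup>2"
    by simp
qed simp

instance ell2 :: complete_space
proof
  fix X :: "nat \<Rightarrow> ell2"
  assume C: "Cauchy X"
  have "Cauchy (\<lambda>m. ell2_nth (X m) n)" for n
  proof (rule CauchyI)
    fix e :: real assume "0 < e"
    then obtain M where M: "\<forall>i\<ge>M. \<forall>j\<ge>M. norm (X i - X j) < e"
      using CauchyD[OF C] by blast
    have "norm (ell2_nth (X i) n - ell2_nth (X j) n) < e" if "i \<ge> M" "j \<ge> M" for i j
      using abs_ell2_nth_le_norm[of "X i - X j" n] M that
      by (fastforce simp: minus_ell2.rep_eq)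
    then show "\<exists>M. \<forall>i\<ge>M. \<forall>j\<ge>M. norm (ell2_nth (X i) n - ell2_nth (X j) n) < e"
      by blast
  qed
  then obtain g where g: "\<And>n. (\<lambda>m. ell2_nth (X m) n) \<longlonglongrightarrow> g n"
    unfolding Cauchy_convergent_iff convergent_def by metis
  have bound: "\<exists>M. \<forall>i\<ge>M. \<forall>k. (\<Sum>n<k. (ell2_nth (X i) n - g n)\<^sup>2) \<le> e\<^sup>2" if "0 < e" for e :: real
  proof -
    obtain M where M: "\<forall>i\<ge>M. \<forall>j\<ge>M. norm (X i - X j) < e"
      using CauchyD[OF C \<open>0 < e\<close>] by blast
    have "(\<Sum>n<k. (ell2_nth (X i) n - g n)\<^sup>2) \<le> e\<^sup>2" if i: "i \<ge> M" for i k
    proof (rule LIMSEQ_le_const2)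
      show "(\<lambda>j. \<Sum>n<k. (ell2_nth (X i) n - ell2_nth (X j) n)\<^sup>2)
              \<longlonglongrightarrow> (\<Sum>n<k. (ell2_nth (X i) n - g n)\<^sup>2)"
        by (intro tendsto_intros g)
      have "(\<Sum>n<k. (ell2_nth (X i) n - ell2_nth (X j) n)\<^sup>2) \<le> e\<^sup>2" if "j \<ge> M" for j
      proof -
        have "(\<Sum>n<k. (ell2_nth (X i) n - ell2_nth (X j) n)\<^sup>2) \<le> (norm (X i - X j))\<^sup>2"
          using sum_squares_le_norm_ell2[of "X i - X j" k] by (simp add: minus_ell2.rep_eq)
        also have "\<dots> \<le> e\<^sup>2"
          using M i that by (intro power_mono) (auto intro: less_imp_le)
        finally show ?thesis .
      qed
      then show "\<exists>N. \<forall>j\<ge>N. (\<Sum>n<k. (ell2_nth (X i) n - ell2_nth (X j) n)\<^sup>2) \<le> e\<^sup>2"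
        by blast
    qed
    then show ?thesis by blast
  qed
  have summ: "summable (\<lambda>n. (ell2_nth (X i) n - g n)\<^sup>2)"
    if "\<forall>k. (\<Sum>n<k. (ell2_nth (X i) n - g n)\<^sup>2) \<le> b" for i b
    using that by (intro bounded_imp_summable[where B = b]) (auto simp flip: lessThan_Suc_atMost simp del: sum.lessThan_Suc)
  obtain i where i: "summable (\<lambda>n. (ell2_nth (X i) n - g n)\<^sup>2)"
    using bound[of 1] summ by (metis order_refl zero_less_one)
  have "summable (\<lambda>n. (g n)\<^sup>2)"
  proof -
    have "summable (\<lambda>n. (- (ell2_nth (X i) n - g n))\<^sup>2)"
      using i by (simp only: power2_minus)
    from summable_square_add[OF summable_ell2_nth this, of "X i"] show ?thesis
      by simp
  qed
  then have nth: "ell2_nth (Abs_ell2 g) = g"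
    by (simp add: Abs_ell2_inverse)
  have "X \<longlonglongrightarrow> Abs_ell2 g"
  proof (rule LIMSEQ_I)
    fix r :: real assume "0 < r"
    then obtain M where M: "\<forall>i\<ge>M. \<forall>k. (\<Sum>n<k. (ell2_nth (X i) n - g n)\<^sup>2) \<le> (r / 2)\<^sup>2"
      using bound[of "r / 2"] by auto
    have "norm (X i - Abs_ell2 g) < r" if "i \<ge> M" for i
    proof -
      have le: "\<forall>k. (\<Sum>n<k. (ell2_nth (X i) n - g n)\<^sup>2) \<le> (r / 2)\<^sup>2"
        using M that by blast
      have "(\<Sum>n. (ell2_nth (X i) n - g n)\<^sup>2) \<le> (r / 2)\<^sup>2"
        using le by (intro suminf_le_const summ) auto
      then have "norm (X i - Abs_ell2 g) \<le> sqrt ((r / 2)\<^sup>2)"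
        unfolding norm_ell2_def minus_ell2.rep_eq nth by (rule real_sqrt_le_mono)
      then show ?thesis
        using \<open>0 < r\<close> by simp
    qed
    then show "\<exists>M. \<forall>i\<ge>M. norm (X i - Abs_ell2 g) < r"
      by blast
  qed
  then show "convergent X"
    by (rule convergentI)
qed


section \<open>The Tikhonov functional\<close>

definition ell1_norm :: "ell2 \<Rightarrow> ereal"
  where "ell1_norm x =
    (if summable (\<lambda>n. \<bar>ell2_nth x n\<bar>) then ereal (\<Sum>n. \<bar>ell2_nth x n\<bar>) else \<infinity>)"

definition tikhonov_functional ::
  "real \<Rightarrow> real \<Rightarrow> (ell2 \<Rightarrow> 'y::real_inner) \<Rightarrow> 'y \<Rightarrow> ell2 \<Rightarrow> ereal"
  where "tikhonov_functional \<alpha> \<beta> A y x =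
    (if ell1_norm x = \<infinity> then \<infinity>
     else ereal (1 / 2 * (norm (A x - y))\<^sup>2) + ereal \<alpha> * (ell1_norm x)\<^sup>2
            - ereal (\<beta> * (norm x)\<^sup>2))"

definition is_minimizer :: "('a \<Rightarrow> ereal) \<Rightarrow> 'a \<Rightarrow> bool"
  where "is_minimizer J x \<longleftrightarrow> (\<forall>z. J x \<le> J z)"

definition sparse :: "ell2 \<Rightarrow> bool"
  where "sparse x \<longleftrightarrow> finite {n. ell2_nth x n \<noteq> 0}"

lemma tikhonov_functional_eq:
  "tikhonov_functional \<alpha> \<beta> A y x =
    (if summable (\<lambda>n. \<bar>ell2_nth x n\<bar>)
     then ereal (1 / 2 * (norm (A x - y))\<^sup>2 + \<alpha> * (\<Sum>n. \<bar>ell2_nth x n\<bar>)\<^sup>2 - \<beta> * (norm x)\<^sup>2)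
     else \<infinity>)"
  by (simp add: tikhonov_functional_def ell1_norm_def ereal_power)

end

theory Submission
  imports Defs
begin

text \<open>
  Zeroing one nonzero component \<open>x\<^sub>n\<close> of a minimizer \<open>x\<close> lowers the \<open>\<ell>\<^sub>1\<close> norm
  \<open>L = \<parallel>x\<parallel>\<^sub>1\<close> by \<open>\<bar>x\<^sub>n\<bar>\<close>, hence the penalty \<open>\<alpha>L\<^sup>2\<close> by about \<open>2\<alpha>L\<bar>x\<^sub>n\<bar>\<close>, which is of first
  order in \<open>\<bar>x\<^sub>n\<bar>\<close>. With \<open>r = Ax - y\<close> and the unit vector \<open>e\<^sub>n\<close>, the fidelity term
  changes by \<open>-x\<^sub>n \<langle>Ae\<^sub>n, r\<rangle>\<close> up to second order, and the \<open>\<ell>\<^sub>2\<close> term is itself of second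
  order. Minimality therefore gives, after division by \<open>\<bar>x\<^sub>n\<bar>\<close>,
  \<open>2\<alpha>L \<le> \<bar>\<langle>Ae\<^sub>n, r\<rangle>\<bar> + C \<bar>x\<^sub>n\<bar>\<close> with \<open>C\<close> independent of \<open>n\<close>
  (lemma \<open>minimizer_nonzero_component_bound\<close>).
  The right-hand side tends to zero, because \<open>x\<close> is square-summable and because bounded
  functionals tend to zero along the unit vectors
  (lemma \<open>bounded_functional_unit_tendsto_0\<close>). As soon as \<open>x \<noteq> 0\<close>, the left-hand side
  is a positive constant, so the inequality can hold for finitely many \<open>n\<close> only.
\<close>

lift_definition ell2_unit :: "nat \<Rightarrow> ell2" is "\<lambda>n k. if k = n then 1 else 0"
  subgoal for n by (rule summable_finite[of "{n}"]) auto
  done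

lemma inner_ell2_unit: "inner x (ell2_unit n) = ell2_nth x n"
proof -
  have "(\<lambda>k. ell2_nth x k * ell2_nth (ell2_unit n) k) = (\<lambda>k. if k = n then ell2_nth x k else 0)"
    by (auto simp: ell2_unit.rep_eq)
  then show ?thesis
    unfolding inner_ell2_def using sums_unique[OF sums_single[of n "ell2_nth x"]] by simp
qed

lemma norm_ell2_unit [simp]: "norm (ell2_unit n) = 1"
  by (simp add: norm_eq_sqrt_inner inner_ell2_unit ell2_unit.rep_eq)

lemma ell2_nth_tendsto_0: "ell2_nth x \<longlonglongrightarrow> 0"
  using summable_LIMSEQ_zero[OF summable_ell2_nth[of x]] by simp

text \<open>
  The squares of the values \<open>f(e\<^sub>n)\<close> are summable by Bessel's inequality for the Riesz
  representative of \<open>f\<close>. The inequality comes without the representative: testing \<open>f\<close> on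
  \<open>v = \<Sum>n<N. f(e\<^sub>n) e\<^sub>n\<close> gives \<open>f v = \<parallel>v\<parallel>\<^sup>2 = \<Sum>n<N. f(e\<^sub>n)\<^sup>2\<close>, and boundedness of \<open>f\<close>
  bounds these sums uniformly in \<open>N\<close>.
\<close>
lemma bounded_functional_unit_tendsto_0:
  fixes f :: "ell2 \<Rightarrow> real"
  assumes "bounded_linear f"
  shows "(\<lambda>n. f (ell2_unit n)) \<longlonglongrightarrow> 0"
proof -
  interpret f: bounded_linear f by fact
  obtain K where K: "\<And>v. norm (f v) \<le> norm v * K"
    using f.bounded by blast
  have "(\<Sum>n<N. (f (ell2_unit n))\<^sup>2) \<le> K\<^sup>2" for N
  proof -
    define v where "v = (\<Sum>n<N. f (ell2_unit n) *\<^sub>R ell2_unit n)"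
    let ?S = "\<Sum>n<N. (f (ell2_unit n))\<^sup>2"
    have fv: "f v = ?S"
      by (simp add: v_def f.sum f.scaleR power2_eq_square)
    have vn: "ell2_nth v n = f (ell2_unit n)" if "n < N" for n
      using that by (simp add: inner_ell2_unit[symmetric] v_def inner_sum_left)
        (simp add: inner_ell2_unit ell2_unit.rep_eq if_distrib cong: if_cong)
    have "inner v v = (\<Sum>n<N. f (ell2_unit n) * inner v (ell2_unit n))"
      by (subst (2) v_def) (simp add: inner_sum_right)
    also have "\<dots> = ?S"
      by (simp add: inner_ell2_unit vn power2_eq_square)
    finally have nv: "(norm v)\<^sup>2 = ?S"
      by (simp add: power2_norm_eq_inner)
    have "(norm v)\<^sup>2 \<le> norm v * K"
      using K[of v] fv nv by simp
    then have "norm v \<le> \<bar>K\<bar>"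
      by (cases "norm v = 0") (auto simp: power2_eq_square)
    then show ?thesis
      using nv power_mono[of "norm v" "\<bar>K\<bar>" 2] by simp
  qed
  then have "summable (\<lambda>n. (f (ell2_unit n))\<^sup>2)"
    by (intro bounded_imp_summable[where B = "K\<^sup>2"])
      (auto simp flip: lessThan_Suc_atMost simp del: sum.lessThan_Suc)
  from summable_LIMSEQ_zero[OF this] show ?thesis
    by simp
qed

lemma minimizer_summable:
  assumes "is_minimizer (tikhonov_functional \<alpha> \<beta> A y) x"
  shows "summable (\<lambda>k. \<bar>ell2_nth x k\<bar>)"
proof (rule ccontr)
  assume "\<not> ?thesis"
  then have "\<infinity> \<le> tikhonov_functional \<alpha> \<beta> A y 0"
    using assms unfolding is_minimizer_def tikhonov_functional_eq[of _ _ _ _ x] by metis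
  then show False
    by (simp add: tikhonov_functional_eq zero_ell2.rep_eq)
qed

text \<open>
  The competitor is \<open>x\<close> with its \<open>n\<close>-th component set to zero. Full removal, rather than an
  infinitesimal decrease as in the first-order optimality condition, suffices: the additional
  terms are quadratic in \<open>x\<^sub>n\<close> and vanish after division by \<open>\<bar>x\<^sub>n\<bar>\<close> in the limit.
\<close>
lemma minimizer_nonzero_component_bound:
  fixes A :: "ell2 \<Rightarrow> 'y::real_inner"
  assumes A: "bounded_linear A"
    and min: "is_minimizer (tikhonov_functional \<alpha> \<beta> A y) x"
    and nz: "ell2_nth x n \<noteq> 0"
  shows "2 * \<alpha> * (\<Sum>k. \<bar>ell2_nth x k\<bar>)
    \<le> \<bar>inner (A (ell2_unit n)) (A x - y)\<bar>
      + ((onorm A)\<^sup>2 / 2 + \<alpha> + \<beta>) * \<bar>ell2_nth x n\<bar>"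
proof -
  interpret A: bounded_linear A by fact
  let ?c = "ell2_nth x n" and ?e = "ell2_unit n" and ?r = "A x - y"
  let ?L = "\<Sum>k. \<bar>ell2_nth x k\<bar>" and ?b = "inner (A (ell2_unit n)) (A x - y)"
  define z where "z = x - ?c *\<^sub>R ?e"
  have sx: "summable (\<lambda>k. \<bar>ell2_nth x k\<bar>)"
    by (rule minimizer_summable[OF min])
  have "(\<lambda>k. \<bar>ell2_nth z k\<bar>) = (\<lambda>k. \<bar>ell2_nth x k\<bar> - (if k = n then \<bar>ell2_nth x k\<bar> else 0))"
    by (auto simp: z_def minus_ell2.rep_eq scaleR_ell2.rep_eq ell2_unit.rep_eq)
  then have z1: "(\<lambda>k. \<bar>ell2_nth z k\<bar>) sums (?L - \<bar>?c\<bar>)"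
    using sums_diff[OF summable_sums[OF sx] sums_single[of n "\<lambda>k. \<bar>ell2_nth x k\<bar>"]] by simp
  have z2: "(norm z)\<^sup>2 = (norm x)\<^sup>2 - ?c\<^sup>2"
  proof -
    have "inner ?e x = ?c" "inner ?e ?e = 1"
      by (simp_all add: inner_ell2_unit inner_commute[of _ x] ell2_unit.rep_eq)
    then show ?thesis
      unfolding z_def power2_norm_eq_inner
      by (simp add: inner_diff_left inner_diff_right inner_ell2_unit minus_ell2.rep_eq
          scaleR_ell2.rep_eq ell2_unit.rep_eq power2_eq_square)
  qed
  have zA: "(norm (A z - y))\<^sup>2 = (norm ?r)\<^sup>2 - 2 * ?c * ?b + ?c\<^sup>2 * (norm (A ?e))\<^sup>2"
  proof -
    have "A z - y = ?r - ?c *\<^sub>R A ?e"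
      by (simp add: z_def A.diff A.scaleR)
    moreover have "(norm (u - c *\<^sub>R w))\<^sup>2 = (norm u)\<^sup>2 - 2 * c * inner w u + c\<^sup>2 * (norm w)\<^sup>2"
      for u w :: 'y and c
      unfolding power2_norm_eq_inner
      by (simp add: inner_diff_left inner_diff_right inner_commute power2_eq_square algebra_simps)
    ultimately show ?thesis
      by (simp only:)
  qed
  have "1 / 2 * (norm ?r)\<^sup>2 + \<alpha> * ?L\<^sup>2 - \<beta> * (norm x)\<^sup>2
    \<le> 1 / 2 * (norm (A z - y))\<^sup>2 + \<alpha> * (?L - \<bar>?c\<bar>)\<^sup>2 - \<beta> * (norm z)\<^sup>2"
    using min[unfolded is_minimizer_def, rule_format, of z] sx
      sums_summable[OF z1] sums_unique[OF z1, symmetric]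
    by (simp add: tikhonov_functional_eq)
  then have main: "2 * \<alpha> * ?L * \<bar>?c\<bar> \<le> - ?c * ?b + ?c\<^sup>2 * (norm (A ?e))\<^sup>2 / 2 + (\<alpha> + \<beta>) * ?c\<^sup>2"
    unfolding zA z2 by (simp add: power2_diff algebra_simps)
  have "norm (A ?e) \<le> onorm A"
    using onorm[OF A, of ?e] by simp
  then have "(norm (A ?e))\<^sup>2 \<le> (onorm A)\<^sup>2"
    by (simp add: power_mono)
  then have "?c\<^sup>2 * (norm (A ?e))\<^sup>2 \<le> ?c\<^sup>2 * (onorm A)\<^sup>2"
    by (simp add: mult_left_mono)
  moreover have "- ?c * ?b \<le> \<bar>?c\<bar> * \<bar>?b\<bar>"
    by (metis abs_ge_self abs_minus_cancel abs_mult)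
  ultimately have "2 * \<alpha> * ?L * \<bar>?c\<bar>
      \<le> \<bar>?c\<bar> * \<bar>?b\<bar> + ?c\<^sup>2 * (onorm A)\<^sup>2 / 2 + (\<alpha> + \<beta>) * ?c\<^sup>2"
    using main by linarith
  also have "\<dots> = (\<bar>?b\<bar> + ((onorm A)\<^sup>2 / 2 + \<alpha> + \<beta>) * \<bar>?c\<bar>) * \<bar>?c\<bar>"
  proof -
    have "?c\<^sup>2 = \<bar>?c\<bar> * \<bar>?c\<bar>"
      by (simp add: power2_eq_square)
    then show ?thesis
      by (simp only:) (simp add: algebra_simps)
  qed
  finally show ?thesis
    using nz by simp
qed

theorem proposition3p5:
  fixes A :: "ell2 \<Rightarrow> 'y::{real_inner, complete_space}"
    and y\<delta> :: 'y
    and \<alpha> \<beta> :: real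
    and x :: ell2
  assumes "bounded_linear A"
    and "\<alpha> \<ge> \<beta>" and "\<beta> > 0"
    and "is_minimizer (tikhonov_functional \<alpha> \<beta> A y\<delta>) x"
  shows "sparse x"
proof (cases "x = 0")
  case True
  then show ?thesis
    by (simp add: sparse_def zero_ell2.rep_eq)
next
  case False
  then obtain m where m: "ell2_nth x m \<noteq> 0"
    by (metis ell2_eqI zero_ell2.rep_eq)
  let ?L = "\<Sum>k. \<bar>ell2_nth x k\<bar>"
  have "?L > 0"
    using suminf_pos2[OF minimizer_summable[OF assms(4)], of m] m by simp
  then have pos: "2 * \<alpha> * ?L > 0"
    using assms(2,3) by simp
  let ?R = "\<lambda>n. \<bar>inner (A (ell2_unit n)) (A x - y\<delta>)\<bar>
    + ((onorm A)\<^sup>2 / 2 + \<alpha> + \<beta>) * \<bar>ell2_nth x n\<bar>"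
  have "bounded_linear (\<lambda>v. inner (A v) (A x - y\<delta>))"
    by (rule bounded_linear_compose[OF bounded_linear_inner_left assms(1)])
  then have "?R \<longlonglongrightarrow> 0"
    using tendsto_add[OF tendsto_rabs_zero[OF bounded_functional_unit_tendsto_0]
        tendsto_mult_right_zero[OF tendsto_rabs_zero[OF ell2_nth_tendsto_0]]]
    by fastforce
  then have "eventually (\<lambda>n. ?R n < 2 * \<alpha> * ?L) sequentially"
    using pos by (rule order_tendstoD)
  then have "eventually (\<lambda>n. ell2_nth x n = 0) sequentially"
    by (rule eventually_mono)
      (use minimizer_nonzero_component_bound[OF assms(1,4)] in \<open>meson linorder_not_less\<close>)
  then show ?thesis
    by (simp add: sparse_def cofinite_eq_sequentially[symmetric] eventually_cofinite)
qed

end
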